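(* Let $a<b$ be real numbers, let $D$ be a directed set, and for each $\alpha\in D$ let $(\Omega_\alpha,\mathcal{A}_\alpha,\mathbb{P}_\alpha)$ be a probability space and $X_\alpha:\Omega_\alpha\to \ell^\infty([a,b])$ an arbitrary (not necessarily measurable) map. Assume that the following two assertions hold. (iv) For every $t\in[a,b]$, the margin $(X_\alpha(t))_{\alpha\in D}$ is asymptotically tight in $\mathbb{R}$. (v) For every $\eta>0$, $$\lim_{\delta\to 0}\ \sup_{s\in[a,b]}\ \limsup_{\alpha}\ \frac{1}{\delta}\,\mathbb{P}^{*}\Big(\sup_{s-\delta<t<s+\delta,\ t\in[a,b]}|X_\alpha(s)-X_\alpha(t)|>\eta\Big)=0,$$ where $\delta\to 0$ through positive values. Then the field $(X_\alpha)_{\alpha\in D}$ is asymptotically tight in $\ell^\infty([a,b])$.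
   Context: $\ell^\infty([a,b])$ is the space of all bounded real-valued functions on $[a,b]$, equipped with the supremum norm $\|x\|=\sup_{t\in[a,b]}|x(t)|$. For $t\in[a,b]$, $X_\alpha(t):\Omega_\alpha\to\mathbb{R}$ denotes the (not necessarily measurable) map $\omega\mapsto X_\alpha(\omega)(t)$. $\mathbb{P}^{*}$ and $\mathbb{P}_{*}$ denote outer and inner probability; for an event involving $X_\alpha$ they are taken with respect to $\mathbb{P}_\alpha$: for $B\subset\Omega_\alpha$, $\mathbb{P}^{*}(B)=\inf\{\mathbb{P}_\alpha(A): A\supset B,\ A\in\mathcal{A}_\alpha\}$ and $\mathbb{P}_{*}(B)=1-\mathbb{P}^{*}(\Omega_\alpha\setminus B)$. The symbols $\liminf_\alpha$ and $\limsup_\alpha$ are the lower and upper limits of nets indexed by the directed set $D$. Asymptotic tightness: let $S$ be a metric space with metric $d$ (here $S=\ell^\infty([a,b])$ with the supremum norm distance, or $S=\mathbb{R}$ with the usual distance). A net $(Y_\alpha)_{\alpha\in D}$ of arbitrary maps $Y_\alpha:\Omega_\alpha\to S$ is asymptotically tight in $S$ if for every $\varepsilon>0$ there exists a compact set $K_\varepsilon\subset S$ such that for every $\delta>0$, $$\liminf_{\alpha}\ \mathbb{P}_{*}(Y_\alpha\in K_\varepsilon^{\delta})\ \ge\ 1-\varepsilon,$$ where $K_\varepsilon^{\delta}=\{y\in S: d(y,K_\varepsilon)<\delta\}$ is the $\delta$-enlargement of $K_\varepsilon$ and $d(y,K_\varepsilon)=\inf_{x\in K_\varepsilon}d(y,x)$.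 *)

theory Defs
  imports "HOL-Probability.Probability"
begin

definition directed_set :: "'i set \<Rightarrow> 'i rel \<Rightarrow> bool" where
  "directed_set D r \<longleftrightarrow>
     D \<noteq> {} \<and> preorder_on D r \<and> (\<forall>\<alpha>\<in>D. \<forall>\<beta>\<in>D. \<exists>\<gamma>\<in>D. (\<alpha>, \<gamma>) \<in> r \<and> (\<beta>, \<gamma>) \<in> r)"

definition tail_filter :: "'i set \<Rightarrow> 'i rel \<Rightarrow> 'i filter" where
  "tail_filter D r = (INF \<alpha>\<in>D. principal {\<beta>\<in>D. (\<alpha>, \<beta>) \<in> r})"

lemma eventually_tail_filter:
  assumes "directed_set D r"
  shows "eventually P (tail_filter D r) \<longleftrightarrow> (\<exists>\<alpha>\<in>D. \<forall>\<beta>\<in>D. (\<alpha>, \<beta>) \<in> r \<longrightarrow> P \<beta>)"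
proof -
  have tr: "trans r"
    using assms by (simp add: directed_set_def preorder_on_def)
  have "\<exists>\<gamma>\<in>D. principal {\<beta>\<in>D. (\<gamma>, \<beta>) \<in> r}
          \<le> inf (principal {\<beta>\<in>D. (\<alpha>, \<beta>) \<in> r}) (principal {\<beta>\<in>D. (\<alpha>', \<beta>) \<in> r})"
    if in_D: "\<alpha> \<in> D" "\<alpha>' \<in> D" for \<alpha> \<alpha>'
  proof -
    obtain \<gamma> where "\<gamma> \<in> D" "(\<alpha>, \<gamma>) \<in> r" "(\<alpha>', \<gamma>) \<in> r"
      using assms in_D unfolding directed_set_def by meson
    with tr show ?thesis
      by (intro bexI[of _ \<gamma>]) (auto dest: transD)
  qed
  with assms have "eventually P (tail_filter D r)
      \<longleftrightarrow> (\<exists>\<alpha>\<in>D. eventually P (principal {\<beta>\<in>D. (\<alpha>, \<beta>) \<in> r}))"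
    unfolding tail_filter_def by (subst eventually_INF_base) (auto simp: directed_set_def)
  then show ?thesis
    by (auto simp: eventually_principal)
qed

text \<open>The lower and upper limits along the tail filter are those of nets.\<close>

lemma Liminf_tail_filter:
  fixes f :: "'i \<Rightarrow> 'b :: complete_lattice"
  assumes "directed_set D r"
  shows "Liminf (tail_filter D r) f = (SUP \<alpha>\<in>D. INF \<beta>\<in>{\<beta>\<in>D. (\<alpha>, \<beta>) \<in> r}. f \<beta>)"
  unfolding Liminf_def
proof (rule antisym)
  show "(SUP P\<in>{P. eventually P (tail_filter D r)}. INF x\<in>{x. P x}. f x)
          \<le> (SUP \<alpha>\<in>D. INF \<beta>\<in>{\<beta>\<in>D. (\<alpha>, \<beta>) \<in> r}. f \<beta>)"
    using assms
    by (intro SUP_least) (auto simp: eventually_tail_filter intro!: SUP_upper2 INF_superset_mono)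
  show "(SUP \<alpha>\<in>D. INF \<beta>\<in>{\<beta>\<in>D. (\<alpha>, \<beta>) \<in> r}. f \<beta>)
          \<le> (SUP P\<in>{P. eventually P (tail_filter D r)}. INF x\<in>{x. P x}. f x)"
    using assms
    by (intro SUP_least SUP_upper2[where i = "\<lambda>\<beta>. \<beta> \<in> D \<and> (_, \<beta>) \<in> r"])
       (auto simp: eventually_tail_filter)
qed

lemma Limsup_tail_filter:
  fixes f :: "'i \<Rightarrow> 'b :: complete_lattice"
  assumes "directed_set D r"
  shows "Limsup (tail_filter D r) f = (INF \<alpha>\<in>D. SUP \<beta>\<in>{\<beta>\<in>D. (\<alpha>, \<beta>) \<in> r}. f \<beta>)"
  unfolding Limsup_def
proof (rule antisym)
  show "(INF \<alpha>\<in>D. SUP \<beta>\<in>{\<beta>\<in>D. (\<alpha>, \<beta>) \<in> r}. f \<beta>)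
          \<le> (INF P\<in>{P. eventually P (tail_filter D r)}. SUP x\<in>{x. P x}. f x)"
    using assms
    by (intro INF_greatest) (auto simp: eventually_tail_filter intro!: INF_lower2 SUP_subset_mono)
  show "(INF P\<in>{P. eventually P (tail_filter D r)}. SUP x\<in>{x. P x}. f x)
          \<le> (INF \<alpha>\<in>D. SUP \<beta>\<in>{\<beta>\<in>D. (\<alpha>, \<beta>) \<in> r}. f \<beta>)"
    using assms
    by (intro INF_greatest INF_lower2[where i = "\<lambda>\<beta>. \<beta> \<in> D \<and> (_, \<beta>) \<in> r"])
       (auto simp: eventually_tail_filter)
qed

text \<open>
  Outer probability is \<^const>\<open>outer_measure_of\<close>. The subtraction in \<^typ>\<open>ennreal\<close> below is not
  truncated for a probability measure, since the outer probability is then at most 1.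
\<close>

definition inner_prob :: "'w measure \<Rightarrow> 'w set \<Rightarrow> ennreal" where
  "inner_prob M B = 1 - outer_measure_of M (space M - B)"

text \<open>
  The infimum is taken in \<^typ>\<open>ennreal\<close>, so the distance to the empty set is infinite
  and every enlargement of the empty set is empty.
\<close>

definition enlargement :: "'s metric \<Rightarrow> 's set \<Rightarrow> real \<Rightarrow> 's set" where
  "enlargement m K \<delta> = {y \<in> mspace m. (INF x\<in>K. ennreal (mdist m y x)) < ennreal \<delta>}"

definition asymptotically_tight ::
  "'i set \<Rightarrow> 'i rel \<Rightarrow> ('i \<Rightarrow> 'w measure) \<Rightarrow> 's metric \<Rightarrow> ('i \<Rightarrow> 'w \<Rightarrow> 's) \<Rightarrow> bool" where
  "asymptotically_tight D r M m Y \<longleftrightarrow>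
     (\<forall>\<epsilon>>0. \<exists>K. compactin (mtopology_of m) K \<and>
        (\<forall>\<delta>>0. Liminf (tail_filter D r)
                 (\<lambda>\<alpha>. inner_prob (M \<alpha>) {\<omega> \<in> space (M \<alpha>). Y \<alpha> \<omega> \<in> enlargement m K \<delta>})
               \<ge> ennreal (1 - \<epsilon>)))"

text \<open>
  Functions on \<open>[a, b]\<close> are represented as functions on \<^typ>\<open>real\<close> that are \<^const>\<open>undefined\<close>
  outside of \<open>[a, b]\<close>.
\<close>

definition linfty :: "real \<Rightarrow> real \<Rightarrow> (real \<Rightarrow> real) metric" where
  "linfty a b = funspace {a..b} euclidean_metric"

lemma mspace_linfty:
  "mspace (linfty a b) = {x. x \<in> extensional {a..b} \<and> bounded (x ` {a..b})}"
  by (auto simp: linfty_def Met_TC.fspace_def)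

lemma mdist_linfty:
  assumes "a \<le> b" "x \<in> mspace (linfty a b)" "y \<in> mspace (linfty a b)"
  shows "mdist (linfty a b) x y = (SUP t\<in>{a..b}. \<bar>x t - y t\<bar>)"
  using assms by (auto simp: linfty_def Met_TC.fdist_def dist_real_def)

end

theory Submission
  imports Defs "HOL-Complex_Analysis.Great_Picard"
begin

text \<open>
  The idea is to discretise. A regular grid of mesh \<open>\<delta>\<close> on \<open>[a, b]\<close> has about \<open>(b - a) / \<delta>\<close> nodes,
  and by hypothesis the oscillation of \<open>X\<close> around each single node exceeds \<open>\<eta>\<close> with outer
  probability asymptotically \<open>o(\<delta>)\<close>. A union bound over the nodes therefore gives, for every \<open>\<eta>\<close> and every
  \<open>\<epsilon>\<close>, a rounding map \<open>g\<close> of \<open>[a, b]\<close> into itself with finite range such that eventually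
  \<open>\<bar>X t - X (g t)\<bar> \<le> \<eta>\<close> for all \<open>t\<close>, up to outer probability \<open>\<epsilon>\<close>
  (\<open>eventually_small_oscillation\<close>). With \<open>\<eta> = 1\<close>, the field is controlled by its values at finitely
  many nodes, which are bounded because the margins are asymptotically tight; so its supremum norm is eventually bounded by some
  constant \<open>C\<close> up to a small outer probability (\<open>eventually_uniformly_bounded\<close>).

  Choose such roundings \<open>g m\<close> for \<open>\<eta> = 1 / (m + 1)\<close>, with error probabilities that are summable in
  \<open>m\<close>. Let \<open>K\<^sub>N\<close> be the set of functions bounded by \<open>C\<close> that vary by at most \<open>1 / (m + 1)\<close> under
  \<open>g m\<close> for \<open>m < N\<close>, and \<open>K\<close> the intersection of all \<open>K\<^sub>N\<close>. A diagonal argument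
  in the manner of Arzela and Ascoli shows that a sequence with \<open>n\<close>-th term in \<open>K\<^sub>n\<close> has a
  subsequence converging uniformly to an element of \<open>K\<close> (\<open>oscillation_class_subsequence\<close>). This
  gives both that \<open>K\<close> is compact and that each enlargement \<open>K\<^sup>\<delta>\<close> contains some \<open>K\<^sub>N\<close>. The latter
  is what makes the argument work for nets: membership in \<open>K\<^sup>\<delta>\<close> then follows from finitely many
  conditions, each of which holds eventually up to a small outer probability, whereas infinitely many
  conditions need not hold simultaneously from some index on.
\<close>

section \<open>Outer and inner probability\<close>

lemma outer_measure_of_UN_le:
  assumes "finite I" and "\<And>i. i \<in> I \<Longrightarrow> A i \<subseteq> space M"
  shows "outer_measure_of M (\<Union>i\<in>I. A i) \<le> (\<Sum>i\<in>I. outer_measure_of M (A i))"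
proof -
  have "\<forall>i\<in>I. \<exists>E\<in>sets M. A i \<subseteq> E \<and> outer_measure_of M (A i) = emeasure M E"
    using assms(2) outer_measure_of_attain by metis
  then obtain E where E: "\<And>i. i \<in> I \<Longrightarrow> E i \<in> sets M" "\<And>i. i \<in> I \<Longrightarrow> A i \<subseteq> E i"
    "\<And>i. i \<in> I \<Longrightarrow> outer_measure_of M (A i) = emeasure M (E i)"
    by metis
  have "outer_measure_of M (\<Union>i\<in>I. A i) \<le> outer_measure_of M (\<Union>i\<in>I. E i)"
    using E(2) by (intro outer_measure_of_mono) blast
  also have "\<dots> = emeasure M (\<Union>i\<in>I. E i)"
    using E(1) assms(1) by (intro outer_measure_of_eq) auto
  also have "\<dots> \<le> (\<Sum>i\<in>I. emeasure M (E i))"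
    using E(1) assms(1) by (intro emeasure_subadditive_finite) auto
  finally show ?thesis
    using E(3) by simp
qed

lemma outer_measure_of_Un_le:
  assumes "A \<subseteq> space M" "B \<subseteq> space M"
  shows "outer_measure_of M (A \<union> B) \<le> outer_measure_of M A + outer_measure_of M B"
  using outer_measure_of_UN_le[of "UNIV :: bool set" "\<lambda>i. if i then A else B" M] assms
  by (simp add: UNIV_bool Un_commute add.commute)

lemma inner_prob_ge:
  assumes "outer_measure_of M (space M - B) \<le> ennreal \<epsilon>" "0 \<le> \<epsilon>"
  shows "ennreal (1 - \<epsilon>) \<le> inner_prob M B"
proof -
  have "ennreal (1 - \<epsilon>) = 1 - ennreal \<epsilon>"
    using assms(2) by (metis ennreal_1 ennreal_minus)
  then show ?thesis
    unfolding inner_prob_def using assms(1) by (simp add: ennreal_minus_mono)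
qed

lemma outer_measure_of_compl_le:
  assumes "ennreal (1 - \<epsilon>) < inner_prob M B" "0 \<le> \<epsilon>"
  shows "outer_measure_of M (space M - B) \<le> ennreal \<epsilon>"
proof (rule ccontr)
  assume "\<not> ?thesis"
  then have "inner_prob M B \<le> 1 - ennreal \<epsilon>"
    unfolding inner_prob_def by (intro ennreal_minus_mono) auto
  also have "\<dots> = ennreal (1 - \<epsilon>)"
    using assms(2) by (metis ennreal_1 ennreal_minus)
  finally show False
    using assms(1) by simp
qed

lemma eventually_in_tail:
  assumes "directed_set D r"
  shows "eventually (\<lambda>\<alpha>. \<alpha> \<in> D) (tail_filter D r)"
  using assms unfolding eventually_tail_filter[OF assms] directed_set_def by auto

lemma asymptotically_tight_imp_eventually_bounded:
  fixes Y :: "'i \<Rightarrow> 'w \<Rightarrow> real"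
  assumes "asymptotically_tight D r M euclidean_metric Y" and "0 < \<epsilon>"
  obtains C where "eventually (\<lambda>\<alpha>. outer_measure_of (M \<alpha>) {\<omega> \<in> space (M \<alpha>). \<bar>Y \<alpha> \<omega>\<bar> > C}
      \<le> ennreal \<epsilon>) (tail_filter D r)"
proof -
  \<comment> \<open>Halving gives the strict inequality needed to pass from the lower limit to eventual bounds;
    capping at 1 keeps the two levels distinct after truncation at 0.\<close>
  define \<epsilon>' where "\<epsilon>' = min \<epsilon> 1"
  have \<epsilon>': "0 < \<epsilon>'" "\<epsilon>' \<le> \<epsilon>" "\<epsilon>' \<le> 1"
    using assms(2) by (auto simp: \<epsilon>'_def)
  have "0 < \<epsilon>' / 2"
    using \<epsilon>'(1) by simp
  with assms(1) obtain K where K: "compact K"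
    and lim: "\<forall>\<delta>>0. ennreal (1 - \<epsilon>' / 2) \<le> Liminf (tail_filter D r)
      (\<lambda>\<alpha>. inner_prob (M \<alpha>) {\<omega> \<in> space (M \<alpha>). Y \<alpha> \<omega> \<in> enlargement euclidean_metric K \<delta>})"
    unfolding asymptotically_tight_def mtopology_of_euclidean compactin_euclidean_iff by meson
  obtain B where B: "\<And>x. x \<in> K \<Longrightarrow> \<bar>x\<bar> \<le> B"
    using compact_imp_bounded[OF K] by (auto simp: bounded_iff)
  have enl: "\<bar>y\<bar> \<le> B + 1" if y: "y \<in> enlargement euclidean_metric K 1" for y
  proof -
    obtain x where "x \<in> K" "dist y x < 1"
      using y unfolding enlargement_def INF_less_iff
      by (auto simp: ennreal_less_iff simp del: ennreal_1)
    then show ?thesis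
      using B[of x] by (auto simp: dist_real_def)
  qed
  have "ennreal (1 - \<epsilon>') < ennreal (1 - \<epsilon>' / 2)"
    using \<epsilon>' by (intro ennreal_lessI) auto
  also have "\<dots> \<le> Liminf (tail_filter D r)
      (\<lambda>\<alpha>. inner_prob (M \<alpha>) {\<omega> \<in> space (M \<alpha>). Y \<alpha> \<omega> \<in> enlargement euclidean_metric K 1})"
    using lim by simp
  finally have "eventually (\<lambda>\<alpha>. ennreal (1 - \<epsilon>') <
      inner_prob (M \<alpha>) {\<omega> \<in> space (M \<alpha>). Y \<alpha> \<omega> \<in> enlargement euclidean_metric K 1})
      (tail_filter D r)"
    by (rule less_LiminfD)
  then have "eventually (\<lambda>\<alpha>. outer_measure_of (M \<alpha>) {\<omega> \<in> space (M \<alpha>). \<bar>Y \<alpha> \<omega>\<bar> > B + 1}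
      \<le> ennreal \<epsilon>) (tail_filter D r)"
  proof eventually_elim
    case (elim \<alpha>)
    have "outer_measure_of (M \<alpha>) {\<omega> \<in> space (M \<alpha>). \<bar>Y \<alpha> \<omega>\<bar> > B + 1}
        \<le> outer_measure_of (M \<alpha>) (space (M \<alpha>) -
            {\<omega> \<in> space (M \<alpha>). Y \<alpha> \<omega> \<in> enlargement euclidean_metric K 1})"
      by (intro outer_measure_of_mono) (auto dest: enl)
    also have "\<dots> \<le> ennreal \<epsilon>'"
      using elim \<epsilon>' by (intro outer_measure_of_compl_le) auto
    also have "\<dots> \<le> ennreal \<epsilon>"
      using \<epsilon>' by (intro ennreal_leI)
    finally show ?case .
  qed
  then show thesis
    by (rule that)
qed

section \<open>Rounding to a grid\<close>

text \<open>
  For \<open>\<delta> \<le> b - a\<close> the grid has at most \<open>(b - a) / \<delta> + 1 \<le> 2 (b - a) / \<delta>\<close> nodes, so a bound \<open>\<epsilon> / (2 (b - a)) * \<delta>\<close>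
  on the outer probability of a large oscillation around each node, uniform over the nodes, adds up
  to at most \<open>\<epsilon>\<close>. This is what the factor \<open>1 / \<delta>\<close> in the hypothesis on oscillations is for. Since the grid is finite, the
  finitely many eventual bounds hold simultaneously.
\<close>

lemma eventually_small_oscillation:
  fixes a b \<eta> \<epsilon> :: real and X :: "'i \<Rightarrow> 'w \<Rightarrow> real \<Rightarrow> real"
  assumes "a < b" and "directed_set D r"
    and X: "\<And>\<alpha>. \<alpha> \<in> D \<Longrightarrow> X \<alpha> \<in> space (M \<alpha>) \<rightarrow> mspace (linfty a b)"
    and v: "((\<lambda>\<delta>::real. SUP s\<in>{a..b}. Limsup (tail_filter D r)
          (\<lambda>\<alpha>. ennreal (1 / \<delta>) * outer_measure_of (M \<alpha>)
             {\<omega> \<in> space (M \<alpha>). (SUP t\<in>{s - \<delta><..<s + \<delta>} \<inter> {a..b}. \<bar>X \<alpha> \<omega> s - X \<alpha> \<omega> t\<bar>) > \<eta>}))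
       \<longlongrightarrow> 0) (at_right 0)"
    and "0 < \<epsilon>"
  obtains g where "g ` {a..b} \<subseteq> {a..b}" "finite (g ` {a..b})"
    "eventually (\<lambda>\<alpha>. outer_measure_of (M \<alpha>)
       {\<omega> \<in> space (M \<alpha>). \<exists>t\<in>{a..b}. \<bar>X \<alpha> \<omega> t - X \<alpha> \<omega> (g t)\<bar> > \<eta>} \<le> ennreal \<epsilon>) (tail_filter D r)"
proof -
  define F where "F = tail_filter D r"
  define big where "big = (\<lambda>\<delta> s \<alpha>. {\<omega> \<in> space (M \<alpha>).
     (SUP t\<in>{s - \<delta><..<s + \<delta>} \<inter> {a..b}. \<bar>X \<alpha> \<omega> s - X \<alpha> \<omega> t\<bar>) > \<eta>})"
  define c where "c = \<epsilon> / (2 * (b - a))"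
  have c: "0 < c"
    using assms by (simp add: c_def)
  have "eventually (\<lambda>\<delta>. (SUP s\<in>{a..b}. Limsup F
      (\<lambda>\<alpha>. ennreal (1 / \<delta>) * outer_measure_of (M \<alpha>) (big \<delta> s \<alpha>))) < ennreal c) (at_right 0)"
    using v c unfolding F_def big_def by (intro order_tendstoD(2)) auto
  moreover have "eventually (\<lambda>\<delta>. \<delta> \<in> {0<..<b - a}) (at_right (0::real))"
    using assms(1) by (intro eventually_at_right_real) auto
  ultimately have "eventually (\<lambda>\<delta>. (SUP s\<in>{a..b}. Limsup F
      (\<lambda>\<alpha>. ennreal (1 / \<delta>) * outer_measure_of (M \<alpha>) (big \<delta> s \<alpha>))) < ennreal c
      \<and> \<delta> \<in> {0<..<b - a}) (at_right 0)"
    by (rule eventually_conj)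
  then obtain \<delta> where small: "(SUP s\<in>{a..b}. Limsup F
      (\<lambda>\<alpha>. ennreal (1 / \<delta>) * outer_measure_of (M \<alpha>) (big \<delta> s \<alpha>))) < ennreal c"
    and \<delta>: "0 < \<delta>" "\<delta> < b - a"
    using eventually_happens'[OF trivial_limit_at_right_real] by (metis (no_types, lifting) greaterThanLessThan_iff)
  have node: "eventually (\<lambda>\<alpha>. outer_measure_of (M \<alpha>) (big \<delta> s \<alpha>) \<le> ennreal (c * \<delta>)) F"
    if s: "s \<in> {a..b}" for s
  proof -
    have "Limsup F (\<lambda>\<alpha>. ennreal (1 / \<delta>) * outer_measure_of (M \<alpha>) (big \<delta> s \<alpha>)) < ennreal c"
      using SUP_lessD[OF small s] .
    then have "eventually
        (\<lambda>\<alpha>. ennreal (1 / \<delta>) * outer_measure_of (M \<alpha>) (big \<delta> s \<alpha>) < ennreal c) F"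
      by (rule Limsup_lessD)
    then show ?thesis
    proof eventually_elim
      case (elim \<alpha>)
      have "outer_measure_of (M \<alpha>) (big \<delta> s \<alpha>)
          = ennreal \<delta> * (ennreal (1 / \<delta>) * outer_measure_of (M \<alpha>) (big \<delta> s \<alpha>))"
        using \<delta>(1) by (simp add: mult.assoc[symmetric] ennreal_mult[symmetric])
      also have "\<dots> \<le> ennreal \<delta> * ennreal c"
        using elim by (intro mult_left_mono) auto
      finally show ?case
        using \<delta>(1) c by (simp add: ennreal_mult mult.commute)
    qed
  qed
  define i where "i = (\<lambda>t. nat \<lfloor>(t - a) / \<delta>\<rfloor>)"
  define n where "n = nat \<lfloor>(b - a) / \<delta>\<rfloor>"
  define g where "g = (\<lambda>t. a + real (i t) * \<delta>)"
  define G where "G = g ` {a..b}"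
  have i: "real (i t) \<le> (t - a) / \<delta>" "(t - a) / \<delta> < real (i t) + 1" if "t \<in> {a..b}" for t
    using that \<delta>(1) unfolding i_def by (auto simp: of_nat_nat)
  have g: "g t \<le> t" "t < g t + \<delta>" "g t \<in> {a..b}" if "t \<in> {a..b}" for t
  proof -
    show "g t \<le> t"
      using i[OF that] \<delta>(1) unfolding g_def by (auto simp: field_simps)
    show "t < g t + \<delta>"
      using i[OF that] \<delta>(1) unfolding g_def by (auto simp: field_simps)
    show "g t \<in> {a..b}"
      using \<open>g t \<le> t\<close> that \<delta>(1) unfolding g_def by auto
  qed
  have G_sub: "G \<subseteq> (\<lambda>j. a + real j * \<delta>) ` {..n}"
  proof -
    have "i t \<le> n" if "t \<in> {a..b}" for t
      unfolding i_def n_def using that \<delta>(1) by (intro nat_mono floor_mono divide_right_mono) auto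
    then show ?thesis
      unfolding G_def g_def by auto
  qed
  have fin: "finite G"
    using G_sub finite_surj by blast
  have "card G \<le> n + 1"
    using card_mono[OF _ G_sub] card_image_le[of "{..n}" "\<lambda>j. a + real j * \<delta>"] by simp
  then have "real (card G) * \<delta> \<le> (real n + 1) * \<delta>"
    using \<delta>(1) by (intro mult_right_mono) auto
  also have "\<dots> \<le> 2 * (b - a)"
  proof -
    have "real n \<le> (b - a) / \<delta>"
      using \<delta> unfolding n_def by (auto simp: of_nat_nat)
    then have "real n * \<delta> \<le> b - a"
      using \<delta>(1) by (simp add: field_simps)
    then show ?thesis
      using \<delta>(2) by (simp add: algebra_simps)
  qed
  finally have "c * (real (card G) * \<delta>) \<le> c * (2 * (b - a))"
    using c by (intro mult_left_mono) auto
  also have "\<dots> = \<epsilon>"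
    using assms(1) by (simp add: c_def)
  finally have total: "real (card G) * (c * \<delta>) \<le> \<epsilon>"
    by (simp add: mult_ac)
  have "eventually (\<lambda>\<alpha>. \<forall>s\<in>G. outer_measure_of (M \<alpha>) (big \<delta> s \<alpha>) \<le> ennreal (c * \<delta>)) F"
    using fin g(3) node by (intro eventually_ball_finite) (auto simp: G_def)
  moreover have "eventually (\<lambda>\<alpha>. \<alpha> \<in> D) F"
    unfolding F_def using assms(2) by (rule eventually_in_tail)
  ultimately have "eventually (\<lambda>\<alpha>. outer_measure_of (M \<alpha>)
       {\<omega> \<in> space (M \<alpha>). \<exists>t\<in>{a..b}. \<bar>X \<alpha> \<omega> t - X \<alpha> \<omega> (g t)\<bar> > \<eta>} \<le> ennreal \<epsilon>) F"
  proof eventually_elim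
    case (elim \<alpha>)
    have "\<omega> \<in> (\<Union>s\<in>G. big \<delta> s \<alpha>)"
      if \<omega>: "\<omega> \<in> space (M \<alpha>)" and t: "t \<in> {a..b}" and large: "\<bar>X \<alpha> \<omega> t - X \<alpha> \<omega> (g t)\<bar> > \<eta>" for \<omega> t
    proof -
      let ?W = "{g t - \<delta><..<g t + \<delta>} \<inter> {a..b}"
      have "bounded (X \<alpha> \<omega> ` {a..b})"
        using X[OF elim(2)] \<omega> by (auto simp: mspace_linfty)
      then have "\<exists>B. \<forall>u\<in>{a..b}. \<bar>X \<alpha> \<omega> u\<bar> \<le> B"
        by (simp add: bounded_iff)
      then obtain B where B: "\<And>u. u \<in> {a..b} \<Longrightarrow> \<bar>X \<alpha> \<omega> u\<bar> \<le> B"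
        by blast
      \<comment> \<open>Boundedness of the path matters here: the real supremum of an unbounded set carries no
        information.\<close>
      have "bdd_above ((\<lambda>u. \<bar>X \<alpha> \<omega> (g t) - X \<alpha> \<omega> u\<bar>) ` ?W)"
        using B g(3)[OF t] by (intro bdd_aboveI2[of _ _ "2 * B"]) (smt (verit) IntD2)
      moreover have "t \<in> ?W"
        using g[OF t] t by auto
      ultimately have "\<bar>X \<alpha> \<omega> (g t) - X \<alpha> \<omega> t\<bar> \<le> (SUP u\<in>?W. \<bar>X \<alpha> \<omega> (g t) - X \<alpha> \<omega> u\<bar>)"
        by (intro cSUP_upper)
      then have "\<omega> \<in> big \<delta> (g t) \<alpha>"
        using large \<omega> unfolding big_def by (simp add: abs_minus_commute)
      then show ?thesis
        using t by (auto simp: G_def)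
    qed
    then have "outer_measure_of (M \<alpha>)
        {\<omega> \<in> space (M \<alpha>). \<exists>t\<in>{a..b}. \<bar>X \<alpha> \<omega> t - X \<alpha> \<omega> (g t)\<bar> > \<eta>}
        \<le> outer_measure_of (M \<alpha>) (\<Union>s\<in>G. big \<delta> s \<alpha>)"
      by (intro outer_measure_of_mono) blast
    also have "\<dots> \<le> (\<Sum>s\<in>G. outer_measure_of (M \<alpha>) (big \<delta> s \<alpha>))"
      using fin by (intro outer_measure_of_UN_le) (auto simp: big_def)
    also have "\<dots> \<le> (\<Sum>s\<in>G. ennreal (c * \<delta>))"
      using elim(1) by (intro sum_mono) auto
    also have "\<dots> = ennreal (real (card G) * (c * \<delta>))"
      using c \<delta>(1) by (simp add: ennreal_mult ennreal_of_nat_eq_real_of_nat)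
    also have "\<dots> \<le> ennreal \<epsilon>"
      using total by (intro ennreal_leI)
    finally show ?case .
  qed
  then show thesis
    using that[of g] g(3) fin unfolding F_def G_def by blast
qed

text \<open>
  A path that moves by at most 1 under a rounding \<open>g\<close> is bounded by 1 plus the maximum of its
  absolute values at the finitely many nodes of \<open>g\<close>, which are controlled by pointwise tightness.
\<close>

lemma eventually_uniformly_bounded:
  fixes X :: "'i \<Rightarrow> 'w \<Rightarrow> real \<Rightarrow> real" and S :: "real set"
  assumes tight: "\<And>s. s \<in> S \<Longrightarrow> asymptotically_tight D r M euclidean_metric (\<lambda>\<alpha> \<omega>. X \<alpha> \<omega> s)"
    and g: "g ` S \<subseteq> S" "finite (g ` S)"
    and osc: "eventually (\<lambda>\<alpha>. outer_measure_of (M \<alpha>)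
       {\<omega> \<in> space (M \<alpha>). \<exists>t\<in>S. \<bar>X \<alpha> \<omega> t - X \<alpha> \<omega> (g t)\<bar> > 1} \<le> ennreal (\<epsilon> / 2)) (tail_filter D r)"
    and "0 < \<epsilon>"
  obtains C where "eventually (\<lambda>\<alpha>. outer_measure_of (M \<alpha>)
       {\<omega> \<in> space (M \<alpha>). \<exists>t\<in>S. \<bar>X \<alpha> \<omega> t\<bar> > C} \<le> ennreal \<epsilon>) (tail_filter D r)"
proof -
  define G where "G = g ` S"
  define e where "e = \<epsilon> / (2 * (real (card G) + 1))"
  have e: "0 < e"
    using assms(5) by (simp add: e_def)
  have "\<forall>s\<in>G. \<exists>C. eventually (\<lambda>\<alpha>. outer_measure_of (M \<alpha>)
      {\<omega> \<in> space (M \<alpha>). \<bar>X \<alpha> \<omega> s\<bar> > C} \<le> ennreal e) (tail_filter D r)"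
    using asymptotically_tight_imp_eventually_bounded[OF tight e] g(1) unfolding G_def by blast
  from bchoice[OF this] obtain c where c: "\<And>s. s \<in> G \<Longrightarrow> eventually (\<lambda>\<alpha>. outer_measure_of (M \<alpha>)
      {\<omega> \<in> space (M \<alpha>). \<bar>X \<alpha> \<omega> s\<bar> > c s} \<le> ennreal e) (tail_filter D r)"
    by blast
  have fin: "finite G"
    using g(2) by (simp add: G_def)
  have "bdd_above (c ` G)"
    using fin by (intro bdd_above_finite finite_imageI)
  then obtain C where C: "\<And>s. s \<in> G \<Longrightarrow> c s \<le> C"
    unfolding bdd_above_def by blast
  have "eventually (\<lambda>\<alpha>. \<forall>s\<in>G. outer_measure_of (M \<alpha>)
      {\<omega> \<in> space (M \<alpha>). \<bar>X \<alpha> \<omega> s\<bar> > c s} \<le> ennreal e) (tail_filter D r)"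
    using fin c by (intro eventually_ball_finite) auto
  with osc have "eventually (\<lambda>\<alpha>. outer_measure_of (M \<alpha>)
       {\<omega> \<in> space (M \<alpha>). \<exists>t\<in>S. \<bar>X \<alpha> \<omega> t\<bar> > C + 1} \<le> ennreal \<epsilon>) (tail_filter D r)"
  proof eventually_elim
    case (elim \<alpha>)
    let ?O = "{\<omega> \<in> space (M \<alpha>). \<exists>t\<in>S. \<bar>X \<alpha> \<omega> t - X \<alpha> \<omega> (g t)\<bar> > 1}"
    let ?B = "\<lambda>s. {\<omega> \<in> space (M \<alpha>). \<bar>X \<alpha> \<omega> s\<bar> > c s}"
    have "\<omega> \<in> ?O \<union> (\<Union>s\<in>G. ?B s)"
      if "\<omega> \<in> space (M \<alpha>)" "t \<in> S" "\<bar>X \<alpha> \<omega> t\<bar> > C + 1" for \<omega> t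
    proof (cases "\<bar>X \<alpha> \<omega> t - X \<alpha> \<omega> (g t)\<bar> > 1")
      case False
      then have "\<bar>X \<alpha> \<omega> (g t)\<bar> > c (g t)" and "g t \<in> G"
        using that C[of "g t"] by (auto simp: G_def)
      then show ?thesis
        using that by blast
    qed (use that in blast)
    then have "outer_measure_of (M \<alpha>) {\<omega> \<in> space (M \<alpha>). \<exists>t\<in>S. \<bar>X \<alpha> \<omega> t\<bar> > C + 1}
        \<le> outer_measure_of (M \<alpha>) (?O \<union> (\<Union>s\<in>G. ?B s))"
      by (intro outer_measure_of_mono) blast
    also have "\<dots> \<le> outer_measure_of (M \<alpha>) ?O + outer_measure_of (M \<alpha>) (\<Union>s\<in>G. ?B s)"
      by (intro outer_measure_of_Un_le) auto
    also have "\<dots> \<le> outer_measure_of (M \<alpha>) ?O + (\<Sum>s\<in>G. outer_measure_of (M \<alpha>) (?B s))"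
      using fin by (intro add_left_mono outer_measure_of_UN_le) auto
    also have "\<dots> \<le> ennreal (\<epsilon> / 2) + (\<Sum>s\<in>G. ennreal e)"
      using elim by (intro add_mono sum_mono) auto
    also have "\<dots> = ennreal (\<epsilon> / 2 + real (card G) * e)"
      using e assms(5) by (simp add: ennreal_mult ennreal_of_nat_eq_real_of_nat)
    also have "\<dots> \<le> ennreal \<epsilon>"
    proof (rule ennreal_leI)
      have "real (card G) * e \<le> (real (card G) + 1) * e"
        using e by simp
      also have "\<dots> = \<epsilon> / 2"
        unfolding e_def by (simp add: field_simps)
      finally show "\<epsilon> / 2 + real (card G) * e \<le> \<epsilon>"
        by simp
    qed
    finally show ?case .
  qed
  then show thesis
    by (rule that)
qed

section \<open>Compactness\<close>

text \<open>
  The nodes of all the roundings form a countable set, so a diagonal subsequence converges at every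
  node. For each \<open>m\<close> the nodes of \<open>g m\<close> are finitely many, hence the convergence at these is uniform,
  and rounding transfers it to all of \<open>S\<close> at the cost of twice \<open>1 / (m + 1)\<close>. The condition for \<open>m\<close>
  is imposed only from the term \<open>m + 1\<close> on, because the sequences to which this applies run through
  decreasing classes of functions rather than staying in one compact set.
\<close>

lemma uniformly_convergent_subsequence_of_roundings:
  fixes y :: "nat \<Rightarrow> 'a \<Rightarrow> real"
  assumes fin: "\<And>m. finite (g m ` S)" and sub: "\<And>m. g m ` S \<subseteq> S"
    and bd: "\<And>n t. t \<in> S \<Longrightarrow> \<bar>y n t\<bar> \<le> C"
    and osc: "\<And>m n t. m < n \<Longrightarrow> t \<in> S \<Longrightarrow> \<bar>y n t - y n (g m t)\<bar> \<le> inverse (real (Suc m))"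
  obtains k where "strict_mono (k :: nat \<Rightarrow> nat)" "uniformly_convergent_on S (\<lambda>n. y (k n))"
proof -
  have nodes: "countable (\<Union>m. g m ` S)"
    using fin by (intro countable_UN) (auto intro: countable_finite)
  have nodes_bd: "norm (y n t) \<le> C" if "t \<in> (\<Union>m. g m ` S)" for n t
    using that sub bd by fastforce
  obtain k :: "nat \<Rightarrow> nat" where k: "strict_mono k"
    and conv: "\<And>t. t \<in> (\<Union>m. g m ` S) \<Longrightarrow> \<exists>l. (\<lambda>n. y (k n) t) \<longlonglongrightarrow> l"
  proof (rule function_convergent_subsequence[OF nodes nodes_bd])
    fix k :: "nat \<Rightarrow> nat"
    assume 1: "strict_mono k"
      and 2: "\<And>t. t \<in> (\<Union>m. g m ` S) \<Longrightarrow> \<exists>l. (\<lambda>n. y (k n) t) \<longlonglongrightarrow> l"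
    show thesis
      using that[OF 1 2] .
  qed
  define l where "l = (\<lambda>t. lim (\<lambda>n. y (k n) t))"
  have l: "(\<lambda>n. y (k n) t) \<longlonglongrightarrow> l t" if "t \<in> (\<Union>m. g m ` S)" for t
    using conv[OF that] by (simp add: l_def convergent_LIMSEQ_iff[symmetric] convergent_def)
  have "uniformly_Cauchy_on S (\<lambda>n. y (k n))"
    unfolding uniformly_Cauchy_on_def
  proof (intro allI impI)
    fix e :: real
    assume "0 < e"
    then obtain m where m: "inverse (real (Suc m)) < e / 4"
      using reals_Archimedean[of "e / 4"] by auto
    have "eventually (\<lambda>n. \<forall>s\<in>g m ` S. dist (y (k n) s) (l s) < e / 4) sequentially"
      using fin \<open>0 < e\<close> by (intro eventually_ball_finite ballI tendstoD l) auto
    then obtain N where N: "\<And>n s. N \<le> n \<Longrightarrow> s \<in> g m ` S \<Longrightarrow> dist (y (k n) s) (l s) < e / 4"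
      unfolding eventually_sequentially by blast
    have "dist (y (k p) t) (y (k q) t) < e"
      if "t \<in> S" "max N (Suc m) \<le> p" "max N (Suc m) \<le> q" for t p q
    proof -
      have "m < k p" "m < k q"
        using that seq_suble[OF k, of p] seq_suble[OF k, of q] by auto
      then have "\<bar>y (k p) t - y (k p) (g m t)\<bar> < e / 4" "\<bar>y (k q) t - y (k q) (g m t)\<bar> < e / 4"
        using osc[of m "k p" t] osc[of m "k q" t] m \<open>t \<in> S\<close> by linarith+
      moreover have "\<bar>y (k p) (g m t) - l (g m t)\<bar> < e / 4" "\<bar>y (k q) (g m t) - l (g m t)\<bar> < e / 4"
        using N[of p "g m t"] N[of q "g m t"] that by (auto simp: dist_real_def)
      ultimately show ?thesis
        unfolding dist_real_def by linarith
    qed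
    then show "\<exists>N. \<forall>t\<in>S. \<forall>p\<ge>N. \<forall>q\<ge>N. dist (y (k p) t) (y (k q) t) < e"
      by blast
  qed
  then have "uniformly_convergent_on S (\<lambda>n. y (k n))"
    by (rule Cauchy_uniformly_convergent)
  with k show thesis
    by (rule that)
qed

definition oscillation_class ::
    "real \<Rightarrow> real \<Rightarrow> real \<Rightarrow> (nat \<Rightarrow> real \<Rightarrow> real) \<Rightarrow> nat \<Rightarrow> (real \<Rightarrow> real) set" where
  "oscillation_class a b C g N = {x \<in> mspace (linfty a b).
     (\<forall>t\<in>{a..b}. \<bar>x t\<bar> \<le> C) \<and>
     (\<forall>m<N. \<forall>t\<in>{a..b}. \<bar>x t - x (g m t)\<bar> \<le> inverse (real (Suc m)))}"

text \<open>
  The conditions that define the classes are pointwise and closed, and each of them holds for all but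
  finitely many terms of the sequence, so they pass to the uniform limit.
\<close>

lemma oscillation_class_subsequence:
  assumes "a \<le> b"
    and fin: "\<And>m. finite (g m ` {a..b})" and sub: "\<And>m. g m ` {a..b} \<subseteq> {a..b}"
    and y: "\<And>n. y n \<in> oscillation_class a b C g n"
  obtains k z where "strict_mono (k :: nat \<Rightarrow> nat)" "z \<in> (\<Inter>N. oscillation_class a b C g N)"
    "(\<lambda>n. mdist (linfty a b) (y (k n)) z) \<longlonglongrightarrow> 0"
proof -
  have bd: "\<bar>y n t\<bar> \<le> C" if "t \<in> {a..b}" for n t
    using y[of n] that by (auto simp: oscillation_class_def)
  have osc: "\<bar>y n t - y n (g m t)\<bar> \<le> inverse (real (Suc m))" if "m < n" "t \<in> {a..b}" for m n t
    using y[of n] that by (auto simp: oscillation_class_def)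
  obtain k :: "nat \<Rightarrow> nat" where k: "strict_mono k"
    and "uniformly_convergent_on {a..b} (\<lambda>n. y (k n))"
    by (rule uniformly_convergent_subsequence_of_roundings[of g "{a..b}" y C, OF fin sub bd osc])
  then obtain z' where z': "uniform_limit {a..b} (\<lambda>n. y (k n)) z' sequentially"
    by (auto simp: uniformly_convergent_on_def)
  define z where "z = restrict z' {a..b}"
  have z: "uniform_limit {a..b} (\<lambda>n. y (k n)) z sequentially"
    using z' by (rule uniform_limit_cong'[THEN iffD1, rotated -1]) (auto simp: z_def)
  have lim: "(\<lambda>n. y (k n) t) \<longlonglongrightarrow> z t" if "t \<in> {a..b}" for t
    using tendsto_uniform_limitI[OF z that] .
  have z_bd: "\<bar>z t\<bar> \<le> C" if "t \<in> {a..b}" for t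
    using bd[OF that] by (intro LIMSEQ_le_const2[OF tendsto_rabs[OF lim[OF that]]]) auto
  have z_osc: "\<bar>z t - z (g m t)\<bar> \<le> inverse (real (Suc m))" if "t \<in> {a..b}" for m t
  proof (rule LIMSEQ_le_const2)
    show "(\<lambda>n. \<bar>y (k n) t - y (k n) (g m t)\<bar>) \<longlonglongrightarrow> \<bar>z t - z (g m t)\<bar>"
      using that sub by (intro tendsto_intros lim) blast+
    show "\<exists>N. \<forall>n\<ge>N. \<bar>y (k n) t - y (k n) (g m t)\<bar> \<le> inverse (real (Suc m))"
    proof (intro exI[of _ "Suc m"] allI impI)
      fix n
      assume "Suc m \<le> n"
      then have "m < k n"
        using seq_suble[OF k, of n] by auto
      then show "\<bar>y (k n) t - y (k n) (g m t)\<bar> \<le> inverse (real (Suc m))"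
        using that by (rule osc)
    qed
  qed
  have "bounded (z ` {a..b})"
    using z_bd by (intro boundedI[of _ C]) auto
  then have z_in: "z \<in> mspace (linfty a b)"
    unfolding mspace_linfty by (simp add: z_def)
  then have "z \<in> (\<Inter>N. oscillation_class a b C g N)"
    using z_bd z_osc by (auto simp: oscillation_class_def)
  moreover have "(\<lambda>n. mdist (linfty a b) (y (k n)) z) \<longlonglongrightarrow> 0"
  proof (rule LIMSEQ_I)
    fix e :: real
    assume e: "0 < e"
    have "eventually (\<lambda>n. \<forall>t\<in>{a..b}. dist (y (k n) t) (z t) < e / 2) sequentially"
      using uniform_limitD[OF z half_gt_zero[OF e]] .
    then obtain N where N: "\<And>n t. N \<le> n \<Longrightarrow> t \<in> {a..b} \<Longrightarrow> \<bar>y (k n) t - z t\<bar> < e / 2"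
      unfolding eventually_sequentially dist_real_def by blast
    have "norm (mdist (linfty a b) (y (k n)) z - 0) < e" if "N \<le> n" for n
    proof -
      have "mdist (linfty a b) (y (k n)) z = (SUP t\<in>{a..b}. \<bar>y (k n) t - z t\<bar>)"
        using assms(1) y[of "k n"] z_in by (intro mdist_linfty) (auto simp: oscillation_class_def)
      also have "\<dots> \<le> e / 2"
        using assms(1) N[OF that] by (intro cSUP_least) (auto intro: less_imp_le)
      finally show ?thesis
        using e by simp
    qed
    then show "\<exists>N. \<forall>n\<ge>N. norm (mdist (linfty a b) (y (k n)) z - 0) < e"
      by blast
  qed
  ultimately show thesis
    using k that by blast
qed

lemma compactin_INT_oscillation_class:
  assumes "a \<le> b"
    and "\<And>m. finite (g m ` {a..b})" and "\<And>m. g m ` {a..b} \<subseteq> {a..b}"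
  shows "compactin (mtopology_of (linfty a b)) (\<Inter>N. oscillation_class a b C g N)"
proof -
  interpret L: Metric_space "mspace (linfty a b)" "mdist (linfty a b)"
    by (rule Metric_space_mspace_mdist)
  have sub: "oscillation_class a b C g N \<subseteq> mspace (linfty a b)" for N
    by (auto simp: oscillation_class_def)
  show ?thesis
    unfolding mtopology_of_def L.compactin_sequentially
  proof (intro conjI allI impI)
    show "(\<Inter>N. oscillation_class a b C g N) \<subseteq> mspace (linfty a b)"
      using sub by blast
    fix \<sigma> :: "nat \<Rightarrow> real \<Rightarrow> real"
    assume \<sigma>: "range \<sigma> \<subseteq> (\<Inter>N. oscillation_class a b C g N)"
    then have "\<sigma> n \<in> oscillation_class a b C g n" for n
      by blast
    from oscillation_class_subsequence[of a b g \<sigma> C, OF assms this]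
    obtain k z where k: "strict_mono (k :: nat \<Rightarrow> nat)"
      and z: "z \<in> (\<Inter>N. oscillation_class a b C g N)"
      and lim: "(\<lambda>n. mdist (linfty a b) (\<sigma> (k n)) z) \<longlonglongrightarrow> 0"
      by blast
    have "\<sigma> n \<in> mspace (linfty a b)" for n
      using \<sigma> sub by blast
    then have "limitin L.mtopology (\<sigma> \<circ> k) z sequentially"
      unfolding L.limitin_metric_dist_null using lim z sub
      by (auto simp: o_def)
    with k z show "\<exists>l r. l \<in> (\<Inter>N. oscillation_class a b C g N) \<and> strict_mono r \<and>
        limitin L.mtopology (\<sigma> \<circ> r) l sequentially"
      by blast
  qed
qed

text \<open>
  Otherwise a sequence with \<open>n\<close>-th term in the \<open>n\<close>-th class would stay at distance at least \<open>\<delta>\<close>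
  from the intersection of the classes, and yet have a limit point in it.
\<close>

lemma oscillation_class_subset_enlargement:
  assumes "a \<le> b"
    and "\<And>m. finite (g m ` {a..b})" and "\<And>m. g m ` {a..b} \<subseteq> {a..b}" and "0 < \<delta>"
  obtains N where "oscillation_class a b C g N
    \<subseteq> enlargement (linfty a b) (\<Inter>N. oscillation_class a b C g N) \<delta>"
proof -
  have "\<exists>N. oscillation_class a b C g N
    \<subseteq> enlargement (linfty a b) (\<Inter>N. oscillation_class a b C g N) \<delta>"
  proof (rule ccontr)
    assume "\<not> ?thesis"
    then obtain y where y: "\<And>n. y n \<in> oscillation_class a b C g n"
      and far: "\<And>n. y n \<notin> enlargement (linfty a b) (\<Inter>N. oscillation_class a b C g N) \<delta>"
      unfolding subset_iff by metis
    from oscillation_class_subsequence[of a b g y C, OF assms(1,2,3) y]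
    obtain k z where z: "z \<in> (\<Inter>N. oscillation_class a b C g N)"
      and lim: "(\<lambda>n. mdist (linfty a b) (y (k n)) z) \<longlonglongrightarrow> 0"
      by blast
    have "eventually (\<lambda>n. mdist (linfty a b) (y (k n)) z < \<delta>) sequentially"
      using lim assms(4) by (rule order_tendstoD(2))
    then obtain n where "mdist (linfty a b) (y (k n)) z < \<delta>"
      by (auto simp: eventually_sequentially)
    then have "ennreal (mdist (linfty a b) (y (k n)) z) < ennreal \<delta>"
      using assms(4) by (intro ennreal_lessI)
    then have "y (k n) \<in> enlargement (linfty a b) (\<Inter>N. oscillation_class a b C g N) \<delta>"
      using z y[of "k n"] unfolding enlargement_def
      by (auto simp: INF_less_iff oscillation_class_def)
    with far show False
      by blast
  qed
  then show thesis
    using that by blast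
qed

section \<open>Asymptotic tightness of the field\<close>

lemma sum_dyadic_le:
  fixes \<epsilon> :: real
  assumes "0 \<le> \<epsilon>"
  shows "(\<Sum>m<N. \<epsilon> / 2 ^ (m + 2)) \<le> \<epsilon> / 2"
proof -
  have "(\<Sum>m<N. \<epsilon> / 2 ^ (m + 2)) = \<epsilon> / 2 - \<epsilon> / 2 ^ (N + 1)"
    by (induction N) (auto simp: field_simps)
  then show ?thesis
    using assms by simp
qed

theorem theorem2p1:
  fixes a b :: real
    and D :: "'i set" and r :: "'i rel"
    and M :: "'i \<Rightarrow> 'w measure"
    and X :: "'i \<Rightarrow> 'w \<Rightarrow> real \<Rightarrow> real"
  assumes "a < b"
    and "directed_set D r"
    and "\<And>\<alpha>. \<alpha> \<in> D \<Longrightarrow> prob_space (M \<alpha>)"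
    and "\<And>\<alpha>. \<alpha> \<in> D \<Longrightarrow> X \<alpha> \<in> space (M \<alpha>) \<rightarrow> mspace (linfty a b)"
    and iv: "\<And>t. t \<in> {a..b} \<Longrightarrow>
      asymptotically_tight D r M euclidean_metric (\<lambda>\<alpha> \<omega>. X \<alpha> \<omega> t)"
    and v: "\<And>\<eta>::real. \<eta> > 0 \<Longrightarrow>
      ((\<lambda>\<delta>::real. SUP s\<in>{a..b}. Limsup (tail_filter D r)
          (\<lambda>\<alpha>. ennreal (1 / \<delta>) * outer_measure_of (M \<alpha>)
             {\<omega> \<in> space (M \<alpha>). (SUP t\<in>{s - \<delta><..<s + \<delta>} \<inter> {a..b}. \<bar>X \<alpha> \<omega> s - X \<alpha> \<omega> t\<bar>) > \<eta>}))
       \<longlongrightarrow> 0) (at_right 0)"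
  shows "asymptotically_tight D r M (linfty a b) X"
proof -
  have "\<exists>K. compactin (mtopology_of (linfty a b)) K \<and>
      (\<forall>\<delta>>0. ennreal (1 - \<epsilon>) \<le> Liminf (tail_filter D r)
        (\<lambda>\<alpha>. inner_prob (M \<alpha>) {\<omega> \<in> space (M \<alpha>). X \<alpha> \<omega> \<in> enlargement (linfty a b) K \<delta>}))"
    if \<epsilon>: "0 < \<epsilon>" for \<epsilon>
  proof -
    let ?F = "tail_filter D r"
    have rounding: "\<exists>g. g ` {a..b} \<subseteq> {a..b} \<and> finite (g ` {a..b}) \<and>
        eventually (\<lambda>\<alpha>. outer_measure_of (M \<alpha>)
          {\<omega> \<in> space (M \<alpha>). \<exists>t\<in>{a..b}. \<bar>X \<alpha> \<omega> t - X \<alpha> \<omega> (g t)\<bar> > \<eta>} \<le> ennreal e) ?F"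
      if \<eta>: "0 < \<eta>" and e: "0 < e" for \<eta> e
    proof -
      obtain g where "g ` {a..b} \<subseteq> {a..b}" "finite (g ` {a..b})"
        "eventually (\<lambda>\<alpha>. outer_measure_of (M \<alpha>)
          {\<omega> \<in> space (M \<alpha>). \<exists>t\<in>{a..b}. \<bar>X \<alpha> \<omega> t - X \<alpha> \<omega> (g t)\<bar> > \<eta>} \<le> ennreal e) ?F"
        using eventually_small_oscillation[OF assms(1,2,4) v[OF \<eta>] e] .
      then show ?thesis
        by (intro exI[of _ g] conjI)
    qed
    obtain h where h: "h ` {a..b} \<subseteq> {a..b}" "finite (h ` {a..b})"
      "eventually (\<lambda>\<alpha>. outer_measure_of (M \<alpha>)
        {\<omega> \<in> space (M \<alpha>). \<exists>t\<in>{a..b}. \<bar>X \<alpha> \<omega> t - X \<alpha> \<omega> (h t)\<bar> > 1} \<le> ennreal (\<epsilon> / 2 / 2)) ?F"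
      using rounding[OF zero_less_one half_gt_zero[OF half_gt_zero[OF \<epsilon>]]]
      by (elim exE conjE) (rule that)
    obtain C where C: "eventually (\<lambda>\<alpha>. outer_measure_of (M \<alpha>)
        {\<omega> \<in> space (M \<alpha>). \<exists>t\<in>{a..b}. \<bar>X \<alpha> \<omega> t\<bar> > C} \<le> ennreal (\<epsilon> / 2)) ?F"
      using eventually_uniformly_bounded[OF iv h half_gt_zero[OF \<epsilon>]] .
    have "\<forall>m. \<exists>g. g ` {a..b} \<subseteq> {a..b} \<and> finite (g ` {a..b}) \<and>
        eventually (\<lambda>\<alpha>. outer_measure_of (M \<alpha>) {\<omega> \<in> space (M \<alpha>).
          \<exists>t\<in>{a..b}. \<bar>X \<alpha> \<omega> t - X \<alpha> \<omega> (g t)\<bar> > inverse (real (Suc m))}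
          \<le> ennreal (\<epsilon> / 2 ^ (m + 2))) ?F"
      using \<epsilon> by (intro allI rounding) auto
    from choice[OF this] obtain g where g: "\<And>m. g m ` {a..b} \<subseteq> {a..b}" "\<And>m. finite (g m ` {a..b})"
      and osc: "\<And>m. eventually (\<lambda>\<alpha>. outer_measure_of (M \<alpha>) {\<omega> \<in> space (M \<alpha>).
          \<exists>t\<in>{a..b}. \<bar>X \<alpha> \<omega> t - X \<alpha> \<omega> (g m t)\<bar> > inverse (real (Suc m))}
          \<le> ennreal (\<epsilon> / 2 ^ (m + 2))) ?F"
      by (elim exE) blast
    define K where "K = (\<Inter>N. oscillation_class a b C g N)"
    have "a \<le> b"
      using assms(1) by simp
    have "ennreal (1 - \<epsilon>) \<le> Liminf ?F
        (\<lambda>\<alpha>. inner_prob (M \<alpha>) {\<omega> \<in> space (M \<alpha>). X \<alpha> \<omega> \<in> enlargement (linfty a b) K \<delta>})"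
      if \<delta>: "0 < \<delta>" for \<delta>
    proof (rule Liminf_bounded)
      obtain N where N: "oscillation_class a b C g N \<subseteq> enlargement (linfty a b) K \<delta>"
        using oscillation_class_subset_enlargement[OF \<open>a \<le> b\<close> g(2,1) \<delta>, of C]
        unfolding K_def .
      have "eventually (\<lambda>\<alpha>. \<forall>m\<in>{..<N}. outer_measure_of (M \<alpha>) {\<omega> \<in> space (M \<alpha>).
          \<exists>t\<in>{a..b}. \<bar>X \<alpha> \<omega> t - X \<alpha> \<omega> (g m t)\<bar> > inverse (real (Suc m))}
          \<le> ennreal (\<epsilon> / 2 ^ (m + 2))) ?F"
        using osc by (intro eventually_ball_finite) auto
      with C eventually_in_tail[OF assms(2)]
      show "eventually (\<lambda>\<alpha>. ennreal (1 - \<epsilon>) \<le> inner_prob (M \<alpha>)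
          {\<omega> \<in> space (M \<alpha>). X \<alpha> \<omega> \<in> enlargement (linfty a b) K \<delta>}) ?F"
      proof eventually_elim
        case (elim \<alpha>)
        let ?B = "{\<omega> \<in> space (M \<alpha>). \<exists>t\<in>{a..b}. \<bar>X \<alpha> \<omega> t\<bar> > C}"
        let ?O = "\<lambda>m. {\<omega> \<in> space (M \<alpha>).
          \<exists>t\<in>{a..b}. \<bar>X \<alpha> \<omega> t - X \<alpha> \<omega> (g m t)\<bar> > inverse (real (Suc m))}"
        have "\<omega> \<in> ?B \<union> (\<Union>m<N. ?O m)"
          if \<omega>: "\<omega> \<in> space (M \<alpha>)" and "X \<alpha> \<omega> \<notin> enlargement (linfty a b) K \<delta>" for \<omega>
        proof -
          have "X \<alpha> \<omega> \<notin> oscillation_class a b C g N"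
            using that N by blast
          moreover have "X \<alpha> \<omega> \<in> mspace (linfty a b)"
            using assms(4)[OF elim(2)] \<omega> by blast
          ultimately show ?thesis
            using \<omega> unfolding oscillation_class_def by (auto simp: not_le)
        qed
        then have "outer_measure_of (M \<alpha>) (space (M \<alpha>) -
            {\<omega> \<in> space (M \<alpha>). X \<alpha> \<omega> \<in> enlargement (linfty a b) K \<delta>})
            \<le> outer_measure_of (M \<alpha>) (?B \<union> (\<Union>m<N. ?O m))"
          by (intro outer_measure_of_mono) blast
        also have "\<dots> \<le> outer_measure_of (M \<alpha>) ?B + outer_measure_of (M \<alpha>) (\<Union>m<N. ?O m)"
          by (intro outer_measure_of_Un_le) auto
        also have "\<dots> \<le> outer_measure_of (M \<alpha>) ?B + (\<Sum>m<N. outer_measure_of (M \<alpha>) (?O m))"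
          by (intro add_left_mono outer_measure_of_UN_le) auto
        also have "\<dots> \<le> ennreal (\<epsilon> / 2) + (\<Sum>m<N. ennreal (\<epsilon> / 2 ^ (m + 2)))"
          using elim by (intro add_mono sum_mono) auto
        also have "\<dots> = ennreal (\<epsilon> / 2 + (\<Sum>m<N. \<epsilon> / 2 ^ (m + 2)))"
          using \<epsilon> by (subst sum_ennreal) (auto intro!: ennreal_plus[symmetric] sum_nonneg)
        also have "\<dots> \<le> ennreal \<epsilon>"
          using sum_dyadic_le[of \<epsilon> N] \<epsilon> by (intro ennreal_leI) auto
        finally show ?case
          using \<epsilon> by (intro inner_prob_ge) auto
      qed
    qed
    moreover have "compactin (mtopology_of (linfty a b)) K"
      unfolding K_def using \<open>a \<le> b\<close> g(2,1) by (rule compactin_INT_oscillation_class)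
    ultimately show ?thesis
      by blast
  qed
  then show ?thesis
    unfolding asymptotically_tight_def by blast
qed

end
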